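(* For all integers $n\ge 0$, \[ a^{-\{1,2\}}_{5,1}(n)\le a^{-\{1,2\}}_{5,3}(n). \]
   Context: A partition of $n$ is a non-increasing sequence of positive integers summing to $n$; its Young diagram is the left-justified array of boxes whose $i$-th row has $\lambda_i$ boxes. The hook length of a box is the number of boxes directly to its right, plus the number directly below it, plus $1$; a box of hook length $k$ is a $k$-hook. For $t\ge 2$, a $t$-core partition is a partition none of whose hook lengths is divisible by $t$. For a set $C$ of positive integers, $a^{-C}_{t,k}(n)$ denotes the total number of hooks of length $k$ summed over all $t$-core partitions of $n$ none of whose parts belongs to $C$. *)

theory Defs
  imports Main
begin

definition partitions :: "nat \<Rightarrow> nat list set" where
  "partitions n = {xs. sorted_wrt (\<ge>) xs \<and> (\<forall>x\<in>set xs. 0 < x) \<and> sum_list xs = n}"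

text \<open>Rows and columns are numbered from 0, rows downwards: the box \<open>(i, j)\<close> lies in row \<open>i\<close>.\<close>

definition young_diagram :: "nat list \<Rightarrow> (nat \<times> nat) set" where
  "young_diagram xs = {(i, j). i < length xs \<and> j < xs ! i}"

definition arm_length :: "nat list \<Rightarrow> nat \<times> nat \<Rightarrow> nat" where
  "arm_length xs b = card {j. snd b < j \<and> (fst b, j) \<in> young_diagram xs}"

definition leg_length :: "nat list \<Rightarrow> nat \<times> nat \<Rightarrow> nat" where
  "leg_length xs b = card {i. fst b < i \<and> (i, snd b) \<in> young_diagram xs}"

definition hook_length :: "nat list \<Rightarrow> nat \<times> nat \<Rightarrow> nat" where
  "hook_length xs b = arm_length xs b + leg_length xs b + 1"

definition core :: "nat \<Rightarrow> nat list \<Rightarrow> bool" where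
  "core t xs \<longleftrightarrow> (\<forall>b\<in>young_diagram xs. \<not> t dvd hook_length xs b)"

definition num_hooks :: "nat \<Rightarrow> nat list \<Rightarrow> nat" where
  "num_hooks k xs = card {b \<in> young_diagram xs. hook_length xs b = k}"

definition core_hooks_avoiding :: "nat set \<Rightarrow> nat \<Rightarrow> nat \<Rightarrow> nat \<Rightarrow> nat" where
  "core_hooks_avoiding C t k n =
     (\<Sum>xs \<in> {xs \<in> partitions n. core t xs \<and> set xs \<inter> C = {}}. num_hooks k xs)"

text \<open>The index set of this sum and the sets counted above are finite, so that none of the sums
  and cardinalities is 0 by convention.\<close>

lemma finite_partitions: "finite (partitions n)"
proof (rule finite_subset)
  have len: "(\<forall>x\<in>set xs. 0 < x) \<Longrightarrow> length xs \<le> sum_list xs" for xs :: "nat list"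
    by (induction xs) auto
  show "partitions n \<subseteq> {xs. set xs \<subseteq> {..n} \<and> length xs \<le> n}"
    using len by (auto simp: partitions_def dest: member_le_sum_list)
  show "finite {xs. set xs \<subseteq> {..n} \<and> length xs \<le> n}"
    by (rule finite_lists_length_le) simp
qed

lemma finite_young_diagram: "finite (young_diagram xs)"
proof -
  have "young_diagram xs = (SIGMA i:{..<length xs}. {..<xs ! i})"
    by (auto simp: young_diagram_def)
  then show ?thesis by simp
qed

lemma finite_arm: "finite {j. snd b < j \<and> (fst b, j) \<in> young_diagram xs}"
  by (rule finite_subset[of _ "snd ` young_diagram xs"])
    (force simp: finite_young_diagram)+

lemma finite_leg: "finite {i. fst b < i \<and> (i, snd b) \<in> young_diagram xs}"
  by (rule finite_subset[of _ "fst ` young_diagram xs"])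
    (force simp: finite_young_diagram)+

end

theory Submission
  imports Defs
begin

text \<open>The first-column hook lengths (the beta-set) of a partition that is a \<open>5\<close>-core are closed under
  subtracting \<open>5\<close> as long as the result is nonnegative. If no part is \<open>1\<close> or \<open>2\<close>, all of them are at
  least \<open>3\<close>, hence they are congruent to \<open>3\<close> or \<open>4\<close> modulo \<open>5\<close>. So subtracting \<open>3\<close> from one of them
  leaves the beta-set, which means that every row has a \<open>3\<close>-hook, whereas a row never has two
  \<open>1\<close>-hooks. The inequality therefore holds for each partition separately.\<close>

definition beta :: "nat list \<Rightarrow> nat \<Rightarrow> nat" where
  "beta xs i = xs ! i + (length xs - 1 - i)"

definition beta_set :: "nat list \<Rightarrow> nat set" where
  "beta_set xs = beta xs ` {..<length xs}"

lemma arm_length_eq: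
  assumes "i < length xs"
  shows "arm_length xs (i, j) = xs ! i - Suc j"
proof -
  have "{j'. j < j' \<and> (i, j') \<in> young_diagram xs} = {Suc j..<xs ! i}"
    using assms by (auto simp: young_diagram_def)
  then show ?thesis by (simp add: arm_length_def)
qed

text \<open>The second assumption makes \<open>c\<close> the height of column \<open>j\<close>, so
  the boxes below row \<open>i\<close> lie in the rows from \<open>Suc i\<close> up to
  \<open>c - 1\<close>.\<close>

lemma leg_length_eq:
  assumes "c \<le> length xs"
    and "\<And>r. r < length xs \<Longrightarrow> j < xs ! r \<longleftrightarrow> r < c"
  shows "leg_length xs (i, j) = c - Suc i"
proof -
  have "{r. i < r \<and> (r, j) \<in> young_diagram xs} = {Suc i..<c}"
    using assms by (auto simp: young_diagram_def)
  then show ?thesis by (simp add: leg_length_def)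
qed

text \<open>The number \<open>g\<close> splits the rows into the first \<open>c\<close>, with beta
  value above \<open>g\<close>, and the rest, with beta value below \<open>g\<close>. The column of
  height exactly \<open>c\<close> that corresponds to \<open>g\<close> meets row \<open>i\<close> in
  the required box.\<close>

lemma beta_gap_imp_hook:
  assumes sorted: "sorted_wrt (\<ge>) xs"
    and i: "i < length xs"
    and g: "g < beta xs i" "g \<notin> beta_set xs"
  obtains j where "(i, j) \<in> young_diagram xs" "hook_length xs (i, j) = beta xs i - g"
proof -
  let ?m = "length xs"
  have anti: "xs ! s \<le> xs ! r" if "r \<le> s" "s < ?m" for r s
    using sorted_wrt_nth_less[OF sorted, of r s] that by (cases "r = s") auto
  \<comment> \<open>The guard \<open>r < ?m\<close> makes \<open>c\<close> equal to
    \<open>?m\<close> when no beta value lies below \<open>g\<close>. As \<open>g\<close> is itself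
    not a beta value, all rows before \<open>c\<close> lie strictly above it.\<close>
  define c where "c = (LEAST r. r < ?m \<longrightarrow> beta xs r < g)"
  have c_le: "c \<le> ?m"
    unfolding c_def by (rule Least_le) simp
  have at_c: "c < ?m \<longrightarrow> beta xs c < g"
    unfolding c_def by (rule LeastI[of _ ?m]) simp
  have below: "g < beta xs r" if "r < c" for r
  proof -
    have "r < ?m" "\<not> beta xs r < g"
      using not_less_Least[of r "\<lambda>r. r < ?m \<longrightarrow> beta xs r < g"] that by (auto simp: c_def)
    moreover have "beta xs r \<noteq> g"
      using g(2) \<open>r < ?m\<close> by (auto simp: beta_set_def)
    ultimately show ?thesis by simp
  qed
  have "i < c"
  proof (rule ccontr)
    assume "\<not> i < c"
    then have "c \<le> i" by simp
    then have "beta xs i \<le> beta xs c"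
      using anti[of c i] i by (simp add: beta_def)
    then show False
      using at_c g(1) i \<open>c \<le> i\<close> by simp
  qed
  \<comment> \<open>Exactly \<open>?m - c\<close> beta values lie below \<open>g\<close>, so
    \<open>j\<close> counts the gaps below \<open>g\<close>. The subtraction does not truncate, as
    \<open>g_eq\<close> confirms.\<close>
  define j where "j = g - (?m - c)"
  have g_eq: "g = j + (?m - c)"
    using at_c c_le by (cases "c < ?m") (auto simp: j_def beta_def)
  have iff: "j < xs ! r \<longleftrightarrow> r < c" if "r < ?m" for r
  proof (cases "r < c")
    case True
    \<comment> \<open>Rows \<open>c - 1\<close> and \<open>c\<close> are the critical ones:
      comparing their beta values with \<open>g\<close> shows that column \<open>j\<close> ends
      between them, and monotonicity covers all other rows.\<close>
    have "g < beta xs (c - 1)" using below[of "c - 1"] True by simp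
    then have "j < xs ! (c - 1)" using True c_le by (simp add: beta_def g_eq)
    moreover have "xs ! (c - 1) \<le> xs ! r" using True c_le by (intro anti) auto
    ultimately show ?thesis using True by simp
  next
    case False
    then have "c < ?m" using that by simp
    then have "beta xs c < g" using at_c by simp
    then have "xs ! c \<le> j" using \<open>c < ?m\<close> by (simp add: beta_def g_eq)
    then show ?thesis using anti[of c r] False that by simp
  qed
  have "j < xs ! i" using iff i \<open>i < c\<close> by simp
  moreover have "leg_length xs (i, j) = c - Suc i"
    using c_le iff by (rule leg_length_eq)
  then have "hook_length xs (i, j) = beta xs i - g"
    using \<open>j < xs ! i\<close> \<open>i < c\<close> c_le
    by (simp add: hook_length_def arm_length_eq[OF i] beta_def g_eq)
  ultimately show thesis
    using i by (intro that[of j]) (auto simp: young_diagram_def)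
qed

text \<open>A gap at \<open>b - t\<close> would produce a hook of length exactly \<open>t\<close>,
  which a \<open>t\<close>-core excludes.\<close>

lemma core_beta_set_diff:
  assumes "sorted_wrt (\<ge>) xs" "core t xs" "0 < t" "b \<in> beta_set xs" "t \<le> b"
  shows "b - t \<in> beta_set xs"
proof (rule ccontr)
  assume gap: "b - t \<notin> beta_set xs"
  obtain i where i: "i < length xs" "b = beta xs i"
    using assms by (auto simp: beta_set_def)
  then have "b - t < beta xs i" using assms by simp
  then obtain j where "(i, j) \<in> young_diagram xs" "hook_length xs (i, j) = beta xs i - (b - t)"
    by (rule beta_gap_imp_hook[OF assms(1) i(1) _ gap])
  then show False
    using assms i by (auto simp: core_def)
qed

text \<open>Repeated subtraction of \<open>t\<close> stays in the beta-set and ends at the residue.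
  Hence a lower bound for the beta-set also bounds all residues of its elements.\<close>

lemma core_beta_set_mod:
  assumes "sorted_wrt (\<ge>) xs" "core t xs" "0 < t" "b \<in> beta_set xs"
  shows "b mod t \<in> beta_set xs"
  using assms(4)
proof (induction b rule: less_induct)
  case (less b)
  show ?case
  proof (cases "t \<le> b")
    case True
    then have "(b - t) mod t \<in> beta_set xs"
      using less core_beta_set_diff[OF assms(1-3)] assms(3) by simp
    then show ?thesis using True by (simp add: le_mod_geq)
  qed (use less.prems in simp)
qed

text \<open>A box of hook length 1 has arm 0, so it is the last box of its row and is determined by
  that row.\<close>

lemma num_hooks_1_le_length: "num_hooks 1 xs \<le> length xs"
proof -
  let ?H = "{b \<in> young_diagram xs. hook_length xs b = 1}"
  have eq: "snd b = xs ! fst b - 1" if "b \<in> ?H" for b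
    using that by (cases b) (auto simp: young_diagram_def hook_length_def arm_length_eq)
  have "inj_on fst ?H"
    by (intro inj_onI prod_eqI) (use eq in auto)
  moreover have "fst ` ?H \<subseteq> {..<length xs}"
    by (auto simp: young_diagram_def)
  ultimately have "card ?H \<le> card {..<length xs}"
    by (intro card_inj_on_le) auto
  then show ?thesis by (simp add: num_hooks_def)
qed

lemma length_le_num_hooks:
  assumes "\<And>i. i < length xs \<Longrightarrow> \<exists>j. (i, j) \<in> young_diagram xs \<and> hook_length xs (i, j) = k"
  shows "length xs \<le> num_hooks k xs"
proof -
  let ?H = "{b \<in> young_diagram xs. hook_length xs b = k}"
  have "finite ?H" by (simp add: finite_young_diagram)
  moreover have "{..<length xs} \<subseteq> fst ` ?H"
    using assms by force
  ultimately have "card {..<length xs} \<le> card ?H"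
    by (meson card_image_le card_mono finite_imageI order_trans)
  then show ?thesis by (simp add: num_hooks_def)
qed

lemma length_le_num_hooks_3:
  assumes sorted: "sorted_wrt (\<ge>) xs" and core: "core 5 xs" and parts: "\<forall>x\<in>set xs. 3 \<le> x"
  shows "length xs \<le> num_hooks 3 xs"
proof (rule length_le_num_hooks)
  fix i assume i: "i < length xs"
  have ge: "3 \<le> b" if "b \<in> beta_set xs" for b
  proof -
    obtain r where "r < length xs" "b = beta xs r"
      using \<open>b \<in> beta_set xs\<close> by (auto simp: beta_set_def)
    moreover from this have "3 \<le> xs ! r" using parts by simp
    ultimately show ?thesis by (simp add: beta_def)
  qed
  have mod: "3 \<le> b mod 5" if "b \<in> beta_set xs" for b
    using ge core_beta_set_mod[OF sorted core _ that] by simp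
  have bi: "beta xs i \<in> beta_set xs" using i by (simp add: beta_set_def)
  \<comment> \<open>Subtracting 3 turns the only possible residues 3 and 4 into 0 and 1, which do
    not occur in the beta-set.\<close>
  have "beta xs i - 3 \<notin> beta_set xs"
  proof
    assume "beta xs i - 3 \<in> beta_set xs"
    then have "3 \<le> (beta xs i - 3) mod 5" by (rule mod)
    \<comment> \<open>Writing the beta value as \<open>c + 3\<close> removes the truncated
      subtraction.\<close>
    moreover obtain c where c: "beta xs i = c + 3"
      using ge[OF bi] le_Suc_ex by (metis add.commute)
    ultimately have "3 \<le> c mod 5" "3 \<le> (c + 3) mod 5"
      using mod[OF bi] by simp_all
    then show False by presburger
  qed
  moreover have "beta xs i - 3 < beta xs i" using ge[OF bi] by simp
  ultimately obtain j where "(i, j) \<in> young_diagram xs"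
      "hook_length xs (i, j) = beta xs i - (beta xs i - 3)"
    using beta_gap_imp_hook[OF sorted i] by blast
  then show "\<exists>j. (i, j) \<in> young_diagram xs \<and> hook_length xs (i, j) = 3"
    using ge[OF bi] by auto
qed

theorem theorem1p8:
  fixes n :: nat
  shows "core_hooks_avoiding {1, 2} 5 1 n \<le> core_hooks_avoiding {1, 2} 5 3 n"
  unfolding core_hooks_avoiding_def
proof (rule sum_mono)
  fix xs assume "xs \<in> {xs \<in> partitions n. core 5 xs \<and> set xs \<inter> {1, 2} = {}}"
  then have xs: "sorted_wrt (\<ge>) xs" "core 5 xs" "\<forall>x\<in>set xs. 0 < x" "1 \<notin> set xs" "2 \<notin> set xs"
    by (auto simp: partitions_def)
  have "3 \<le> x" if "x \<in> set xs" for x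
  proof -
    have "0 < x" "x \<noteq> 1" "x \<noteq> 2" using xs(3-5) that by auto
    then show ?thesis by simp
  qed
  with xs(1,2) have "length xs \<le> num_hooks 3 xs"
    by (simp add: length_le_num_hooks_3)
  with num_hooks_1_le_length[of xs] show "num_hooks 1 xs \<le> num_hooks 3 xs"
    by (rule order_trans)
qed

end
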